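(* Let $X \in \mathbb{R}^{n\times p}$ be a random matrix whose entries are drawn from a continuous probability distribution on $\mathbb{R}^{np}$. Then for any differentiable, strictly convex function $f:\mathbb{R}^n\to\mathbb{R}$ and any $\lambda>0$, the minimization problem $$\min_{\beta\in\mathbb{R}^p}\; f(X\beta)+\lambda\|\beta\|_1$$ has a unique solution with probability one (over the distribution of $X$). This solution has at most $\min\{n,p\}$ nonzero components.
   Context: "Continuous probability distribution on $\mathbb{R}^{np}$" means that the joint distribution of the $np$ entries of $X$ is absolutely continuous with respect to Lebesgue measure on $\mathbb{R}^{np}$. The function $f$ is strictly convex in its argument $u\in\mathbb{R}^n$; the function $\beta\mapsto f(X\beta)$ need not be strictly convex. A solution is a minimizer over $\beta\in\mathbb{R}^p$, and $\|\beta\|_1=\sum_{i=1}^p|\beta_i|$. The sizes of $n$ and $p$ are arbitrary.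
   Formalization: Existence of a solution is claimed, with probability one, only when the objective f(Xβ)+λ‖β‖₁ is bounded below in β; without this it can fail, e.g. n=p=1, f(u)=e^{-u}−2u, λ=1, X uniform on [1,2]. *)

theory Defs
  imports "HOL-Probability.Probability"
begin

definition strictly_convex_on :: "'a::real_vector set \<Rightarrow> ('a \<Rightarrow> real) \<Rightarrow> bool" where
  "strictly_convex_on S f \<longleftrightarrow>
     convex S \<and>
     (\<forall>x\<in>S. \<forall>y\<in>S. x \<noteq> y \<longrightarrow>
        (\<forall>t. 0 < t \<and> t < 1 \<longrightarrow>
           f ((1 - t) *\<^sub>R x + t *\<^sub>R y) < (1 - t) * f x + t * f y))"

definition l1_norm :: "real ^ 'p \<Rightarrow> real" where
  "l1_norm \<beta> = (\<Sum>i\<in>UNIV. \<bar>\<beta> $ i\<bar>)"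

definition l1_objective ::
  "(real ^ 'n \<Rightarrow> real) \<Rightarrow> real ^ 'p ^ 'n \<Rightarrow> real \<Rightarrow> real ^ 'p \<Rightarrow> real" where
  "l1_objective f X lam \<beta> = f (X *v \<beta>) + lam * l1_norm \<beta>"

(* Differentiability and strict convexity of f do not bound the objective from below:
   for n = p = 1, f u = exp (- u) - 2 * u, lam = 1 and X \<ge> 1 the objective tends to -\<infinity> as
   \<beta> \<rightarrow> \<infinity>, so no solution exists.  Existence therefore presupposes that the infimum of the
   objective is finite (bdd_below); this holds trivially whenever a solution exists, so it
   restricts neither uniqueness nor the bound on the number of nonzero components. *)
definition l1_solution ::
  "(real ^ 'n \<Rightarrow> real) \<Rightarrow> real ^ 'p ^ 'n \<Rightarrow> real \<Rightarrow> real ^ 'p \<Rightarrow> bool" where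
  "l1_solution f X lam \<beta> \<longleftrightarrow> is_arg_min (l1_objective f X lam) (\<lambda>_. True) \<beta>"

end

theory Submission
  imports Defs
begin

text \<open>
  The exceptional matrices form a Lebesgue null set, which \<open>X\<close> avoids almost surely because its
  distribution is absolutely continuous.  It is the union of three sets.

  The first is where existence can fail.  For a fixed matrix, the weights \<open>lam\<close> for which the
  objective is bounded below form an up-closed set.  If it is bounded below for some weight smaller
  than \<open>lam\<close>, the objective for \<open>lam\<close> is coercive and a minimizer exists
  (\<open>l1_solution_exists\<close>).  What is left are the matrices whose threshold weight is exactly \<open>lam\<close>.
  Since the threshold of \<open>c *\<^sub>R X\<close> is \<open>c\<close> times that of \<open>X\<close>, such matrices occur at most once on
  every ray, so they are negligible (\<open>negligible_threshold_matrices\<close>).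

  The other two express that the columns are not in general position.  One consists of the
  matrices with a linear dependence between at most \<open>CARD('n)\<close> columns
  (\<open>negligible_short_dependence\<close>), the other of those for which some vector \<open>v\<close> has inner product
  \<open>\<plusminus>lam\<close> with more than \<open>CARD('n)\<close> columns (\<open>negligible_large_equicorrelation_set\<close>).  Both are
  null by a count of parameters (\<open>negligible_parametrised_coordinates\<close>).

  Outside these sets, let \<open>\<beta>\<close> be a solution and \<open>v\<close> the gradient of \<open>f\<close> at \<open>X *v \<beta>\<close>.  Every column
  in the support of \<open>\<beta>\<close> has inner product \<open>\<plusminus>lam\<close> with \<open>v\<close> by stationarity, so the support has at
  most \<open>CARD('n)\<close> elements.  If \<open>\<gamma>\<close> is another solution, strict convexity gives
  \<open>X *v (\<beta> - \<gamma>) = 0\<close>.  The midpoint is a solution too, and where it vanishes both \<open>\<beta>\<close> and \<open>\<gamma>\<close> do,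
  so \<open>\<beta> - \<gamma>\<close> has at most \<open>CARD('n)\<close> nonzero entries.  Since so few columns are independent,
  \<open>\<beta> = \<gamma>\<close>.
\<close>

section \<open>Matrices with columns not in general position\<close>

text \<open>
  A dimension count.  The points of this set are determined by their coordinates outside
  \<open>e ` K\<close> together with the \<open>card Q\<close> multipliers \<open>c\<close>, which is fewer parameters than the
  dimension of the space.  To apply the theorem on differentiable images of null sets without
  changing the space, the multipliers are stored in the coordinates \<open>e ` K\<close>; as there are more
  of these than multipliers, one coordinate is left over, and the set is the image under a
  differentiable map of the hyperplane on which that coordinate vanishes.
\<close>
lemma negligible_parametrised_coordinates:
  fixes e :: "'k \<Rightarrow> 'a::euclidean_space" and h :: "'q \<Rightarrow> 'k \<Rightarrow> 'a \<Rightarrow> real"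
  assumes fin: "finite K" "finite Q" and card: "card Q < card K"
    and e: "e ` K \<subseteq> Basis" "inj_on e K"
    and diff: "\<And>q k. q \<in> Q \<Longrightarrow> k \<in> K \<Longrightarrow> h q k differentiable_on UNIV"
    and indep: "\<And>q k x y. q \<in> Q \<Longrightarrow> k \<in> K \<Longrightarrow>
                  (\<And>b. b \<in> Basis - e ` K \<Longrightarrow> x \<bullet> b = y \<bullet> b) \<Longrightarrow> h q k x = h q k y"
  shows "negligible {x. \<exists>c. \<forall>k\<in>K. x \<bullet> e k = (\<Sum>q\<in>Q. c q * h q k x)}"
proof -
  \<comment> \<open>The multiplier with index \<open>q\<close> is stored in the coordinate \<open>e (\<sigma> q)\<close>; \<open>e k0\<close> stays free.\<close>
  obtain \<sigma> where \<sigma>: "inj_on \<sigma> Q" "\<sigma> ` Q \<subseteq> K"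
    using card_le_inj[of Q K] fin card by auto
  have "\<sigma> ` Q \<noteq> K"
    using card card_image[OF \<sigma>(1)] by auto
  then obtain k0 where k0: "k0 \<in> K" "k0 \<notin> \<sigma> ` Q"
    using \<sigma>(2) by blast
  have e\<sigma>: "inj_on (e \<circ> \<sigma>) Q"
    using \<sigma> e(2) by (meson comp_inj_on inj_on_subset)
  have ek0: "e k0 \<notin> (e \<circ> \<sigma>) ` Q"
  proof
    assume "e k0 \<in> (e \<circ> \<sigma>) ` Q"
    then obtain q where q: "q \<in> Q" "e k0 = e (\<sigma> q)" by auto
    then have "k0 = \<sigma> q"
      using inj_onD[OF e(2) q(2) k0(1)] \<sigma>(2) by blast
    then show False using k0(2) q(1) by blast
  qed
  define F where "F y = (\<Sum>b\<in>Basis. (if b \<in> e ` K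
      then (\<Sum>q\<in>Q. (y \<bullet> e (\<sigma> q)) * h q (inv_into K e b) y) else y \<bullet> b) *\<^sub>R b)" for y
  have "F differentiable (at y within {y. e k0 \<bullet> y = 0})" for y
  proof -
    have lin: "(\<lambda>y. y \<bullet> b) differentiable (at y within {y. e k0 \<bullet> y = 0})" for b
      by (intro bounded_linear_imp_differentiable bounded_linear_inner_left)
    have "h q k differentiable (at y within {y. e k0 \<bullet> y = 0})" if "q \<in> Q" "k \<in> K" for q k
      using diff[OF that] unfolding differentiable_on_def
      by (meson UNIV_I differentiable_within_subset subset_UNIV)
    then have "(\<lambda>y. \<Sum>q\<in>Q. (y \<bullet> e (\<sigma> q)) * h q (inv_into K e b) y)
        differentiable (at y within {y. e k0 \<bullet> y = 0})" if "b \<in> e ` K" for b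
      using inv_into_into[OF that] fin lin
      by (intro differentiable_sum differentiable_mult) auto
    then have "(\<lambda>y. if b \<in> e ` K then (\<Sum>q\<in>Q. (y \<bullet> e (\<sigma> q)) * h q (inv_into K e b) y) else y \<bullet> b)
        differentiable (at y within {y. e k0 \<bullet> y = 0})" for b
      using lin by (cases "b \<in> e ` K") simp_all
    then show ?thesis
      unfolding F_def by (intro differentiable_sum differentiable_scaleR) simp_all
  qed
  then have "F differentiable_on {y. e k0 \<bullet> y = 0}"
    by (simp add: differentiable_on_def)
  moreover have "negligible {y. e k0 \<bullet> y = 0}"
    using e(1) k0(1) by (intro negligible_hyperplane) auto
  ultimately have "negligible (F ` {y. e k0 \<bullet> y = 0})"
    by (intro negligible_differentiable_image_negligible) auto
  moreover have "{x. \<exists>c. \<forall>k\<in>K. x \<bullet> e k = (\<Sum>q\<in>Q. c q * h q k x)} \<subseteq> F ` {y. e k0 \<bullet> y = 0}"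
  proof safe
    fix x c
    assume x: "\<forall>k\<in>K. x \<bullet> e k = (\<Sum>q\<in>Q. c q * h q k x)"
    define y where "y = (\<Sum>b\<in>Basis. (if b \<in> (e \<circ> \<sigma>) ` Q then c (inv_into Q (e \<circ> \<sigma>) b)
                          else if b \<in> e ` K then 0 else x \<bullet> b) *\<^sub>R b)"
    have y_param: "y \<bullet> e (\<sigma> q) = c q" if "q \<in> Q" for q
    proof -
      have "e (\<sigma> q) \<in> Basis" using e \<sigma> that by auto
      moreover have "inv_into Q (e \<circ> \<sigma>) (e (\<sigma> q)) = q"
        using inv_into_f_f[OF e\<sigma> that] by simp
      ultimately show ?thesis
        using that unfolding y_def by (simp add: inner_sum_left_Basis)
    qed
    have y_rest: "y \<bullet> b = x \<bullet> b" if "b \<in> Basis - e ` K" for b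
    proof -
      have "b \<notin> (e \<circ> \<sigma>) ` Q" using that \<sigma>(2) by auto
      with that show ?thesis unfolding y_def by (simp add: inner_sum_left_Basis)
    qed
    have "e k0 \<bullet> y = 0"
      using ek0 e(1) k0(1) unfolding y_def inner_commute[of "e k0"]
      by (subst inner_sum_left_Basis) auto
    moreover have "x = F y"
    proof (rule euclidean_eqI)
      fix b :: 'a assume b: "b \<in> Basis"
      show "x \<bullet> b = F y \<bullet> b"
      proof (cases "b \<in> e ` K")
        case True
        then obtain k where k: "k \<in> K" "b = e k" by blast
        have "h q k y = h q k x" if "q \<in> Q" for q
          using indep[OF that k(1)] y_rest by blast
        then show ?thesis
          using b k x y_param inv_into_f_f[OF e(2) k(1)] unfolding F_def
          by (simp add: inner_sum_left_Basis)
      next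
        case False
        then show ?thesis
          using b y_rest unfolding F_def by (simp add: inner_sum_left_Basis)
      qed
    qed
    ultimately show "x \<in> F ` {y. e k0 \<bullet> y = 0}" by blast
  qed
  ultimately show ?thesis by (rule negligible_subset)
qed

text \<open>
  A column occurring in the dependence is a combination of the at most \<open>CARD('n) - 1\<close> others in
  \<open>A\<close>, so its \<open>CARD('n)\<close> entries are given by too few multipliers.
\<close>
lemma negligible_dependent_columns:
  fixes A :: "'p::finite set"
  assumes "card A \<le> CARD('n::finite)"
  shows "negligible {X :: real^'p^'n. \<exists>d. d \<noteq> 0 \<and> {j. d $ j \<noteq> 0} \<subseteq> A \<and> X *v d = 0}"
proof -
  define B where "B i = {X :: real^'p^'n. \<exists>c. \<forall>r\<in>UNIV.
      X \<bullet> axis r (axis i 1) = (\<Sum>q\<in>A - {i}. c q * X $ r $ q)}" for i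
  have "negligible (B i)" if "i \<in> A" for i
    unfolding B_def
  proof (rule negligible_parametrised_coordinates)
    have "card A > 0" using that by (auto simp: card_gt_0_iff)
    then show "card (A - {i}) < card (UNIV :: 'n set)"
      using that assms by simp
    show "(\<lambda>X::real^'p^'n. X $ r $ q) differentiable_on UNIV" for r q
      by (intro linear_imp_differentiable_on) (auto intro!: linearI)
    show "X $ r $ q = Y $ r $ q"
      if "q \<in> A - {i}" and eq: "\<And>b. b \<in> Basis - range (\<lambda>r. axis r (axis i 1)) \<Longrightarrow> X \<bullet> b = Y \<bullet> b"
      for r q and X Y :: "real^'p^'n"
    proof -
      have "axis r (axis q 1) \<in> Basis - range (\<lambda>r. axis r (axis i (1::real)))"
        using that(1) by (auto simp: axis_eq_axis axis_in_Basis_iff)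
      from eq[OF this] show ?thesis by (simp add: inner_axis)
    qed
  qed (auto simp: inj_on_def axis_eq_axis axis_in_Basis_iff)
  then have "negligible (\<Union>i\<in>A. B i)"
    by (intro negligible_Union) auto
  moreover have "X \<in> (\<Union>i\<in>A. B i)"
    if d: "d \<noteq> 0" "{j. d $ j \<noteq> 0} \<subseteq> A" "X *v d = 0" for X :: "real^'p^'n" and d
  proof -
    obtain i where i: "d $ i \<noteq> 0" using d(1) by (auto simp: vec_eq_iff)
    with d have iA: "i \<in> A" by auto
    have "X $ r $ i = (\<Sum>q\<in>A - {i}. - (d $ q / d $ i) * X $ r $ q)" for r
    proof -
      have "0 = (\<Sum>q\<in>UNIV. X $ r $ q * d $ q)"
        using d(3) by (simp add: vec_eq_iff matrix_vector_mult_def)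
      also have "\<dots> = (\<Sum>q\<in>A. X $ r $ q * d $ q)"
        using d(2) by (intro sum.mono_neutral_right) auto
      also have "\<dots> = X $ r $ i * d $ i + (\<Sum>q\<in>A - {i}. X $ r $ q * d $ q)"
        using iA by (simp add: sum.remove)
      finally have "X $ r $ i = - (\<Sum>q\<in>A - {i}. X $ r $ q * d $ q) / d $ i"
        using i by (simp add: field_simps)
      then show ?thesis
        by (simp add: sum_divide_distrib sum_negf mult.commute)
    qed
    then have "\<exists>c. \<forall>r\<in>UNIV. X \<bullet> axis r (axis i 1) = (\<Sum>q\<in>A - {i}. c q * X $ r $ q)"
      by (intro exI[of _ "\<lambda>q. - (d $ q / d $ i)"]) (simp add: inner_axis)
    then show ?thesis using iA unfolding B_def by blast
  qed
  ultimately show ?thesis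
    by (elim negligible_subset) blast
qed

text \<open>
  If \<open>v $ r \<noteq> 0\<close>, the equations can be solved for the entries of row \<open>r\<close> in the columns of \<open>A\<close>:
  with \<open>c q = - v $ q / v $ r\<close> for \<open>q \<noteq> r\<close> and \<open>c r = 1 / v $ r\<close> they say that
  \<open>X $ r $ i\<close> equals \<open>c r * s i\<close> plus the sum of \<open>c q * X $ q $ i\<close> over \<open>q \<noteq> r\<close>.  These are more
  than \<open>CARD('n)\<close> entries and only \<open>CARD('n)\<close> multipliers.
\<close>
lemma negligible_equicorrelated_columns:
  fixes A :: "'p::finite set" and s :: "'p \<Rightarrow> real"
  assumes "CARD('n::finite) < card A"
  shows "negligible {X :: real^'p^'n. \<exists>v. v \<noteq> 0 \<and> (\<forall>i\<in>A. column i X \<bullet> v = s i)}"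
proof -
  define h where "h r q i X = (if q = r then s i else X $ q $ i)"
    for r q :: 'n and i :: 'p and X :: "real^'p^'n"
  define B where "B r = {X :: real^'p^'n. \<exists>c. \<forall>i\<in>A.
      X \<bullet> axis r (axis i 1) = (\<Sum>q\<in>UNIV. c q * h r q i X)}" for r
  have "negligible (B r)" for r
    unfolding B_def
  proof (rule negligible_parametrised_coordinates)
    show "card (UNIV :: 'n set) < card A" by (rule assms)
    show "h r q i differentiable_on UNIV" for q i
    proof (cases "q = r")
      case False
      then have "h r q i = (\<lambda>X. X $ q $ i)" by (simp add: h_def fun_eq_iff)
      then show ?thesis
        by (auto intro!: linear_imp_differentiable_on linearI)
    qed (simp add: h_def[abs_def])
    show "h r q i X = h r q i Y"
      if eq: "\<And>b. b \<in> Basis - (\<lambda>i. axis r (axis i 1)) ` A \<Longrightarrow> X \<bullet> b = Y \<bullet> b"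
      for q i X Y
    proof (cases "q = r")
      case False
      then have "axis q (axis i 1) \<in> Basis - (\<lambda>i. axis r (axis i (1::real))) ` A"
        by (auto simp: axis_eq_axis)
      from eq[OF this] show ?thesis by (simp add: inner_axis h_def)
    qed (simp add: h_def)
  qed (auto simp: inj_on_def axis_eq_axis)
  then have "negligible (\<Union>r. B r)"
    by (intro negligible_Union) auto
  moreover have "X \<in> (\<Union>r. B r)"
    if v: "v \<noteq> 0" "\<forall>i\<in>A. column i X \<bullet> v = s i" for X :: "real^'p^'n" and v
  proof -
    obtain r where r: "v $ r \<noteq> 0" using v(1) by (auto simp: vec_eq_iff)
    define c where "c q = (if q = r then 1 / v $ r else - (v $ q / v $ r))" for q
    have "X $ r $ i = (\<Sum>q\<in>UNIV. c q * h r q i X)" if "i \<in> A" for i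
    proof -
      have "s i = v $ r * X $ r $ i + (\<Sum>q\<in>UNIV - {r}. v $ q * X $ q $ i)"
        using v(2) that sum.remove[of UNIV r "\<lambda>q. v $ q * X $ q $ i"]
        by (simp add: inner_vec_def column_def mult.commute)
      then have "X $ r $ i = s i / v $ r - (\<Sum>q\<in>UNIV - {r}. v $ q * X $ q $ i) / v $ r"
        using r by (simp add: field_simps)
      also have "\<dots> = c r * h r r i X + (\<Sum>q\<in>UNIV - {r}. c q * h r q i X)"
        by (simp add: c_def h_def sum_divide_distrib flip: sum_negf)
      also have "\<dots> = (\<Sum>q\<in>UNIV. c q * h r q i X)"
        by (simp add: sum.remove[of UNIV r])
      finally show ?thesis .
    qed
    then show ?thesis
      unfolding B_def by (auto simp: inner_axis)
  qed
  ultimately show ?thesis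
    by (elim negligible_subset) blast
qed

corollary negligible_short_dependence:
  "negligible {X :: real^'p::finite^'n::finite.
     \<exists>d. d \<noteq> 0 \<and> card {j. d $ j \<noteq> 0} \<le> CARD('n) \<and> X *v d = 0}" (is "negligible ?D")
proof -
  have "negligible (\<Union>A\<in>{A :: 'p set. card A \<le> CARD('n)}.
      {X :: real^'p^'n. \<exists>d. d \<noteq> 0 \<and> {j. d $ j \<noteq> 0} \<subseteq> A \<and> X *v d = 0})"
    by (intro negligible_Union) (auto intro: negligible_dependent_columns)
  then show ?thesis
    by (rule negligible_subset) blast
qed

text \<open>
  For fixed \<open>v\<close>, the columns whose inner product with \<open>v\<close> has absolute value \<open>lam\<close> form the
  equicorrelation set; there are only finitely many choices for it and for the signs on it.
\<close>
corollary negligible_large_equicorrelation_set: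
  assumes "lam > 0"
  shows "negligible {X :: real^'p::finite^'n::finite.
     \<exists>v. CARD('n) < card {i. \<bar>column i X \<bullet> v\<bar> = lam}}"
proof -
  define s where "s P i = (if i \<in> P then lam else - lam)" for P and i :: 'p
  have "negligible (\<Union>(A, P)\<in>{A :: 'p set. CARD('n) < card A} \<times> UNIV.
      {X :: real^'p^'n. \<exists>v. v \<noteq> 0 \<and> (\<forall>i\<in>A. column i X \<bullet> v = s P i)})"
    by (intro negligible_Union) (auto intro: negligible_equicorrelated_columns)
  moreover have "X \<in> (\<Union>(A, P)\<in>{A :: 'p set. CARD('n) < card A} \<times> UNIV.
      {X :: real^'p^'n. \<exists>v. v \<noteq> 0 \<and> (\<forall>i\<in>A. column i X \<bullet> v = s P i)})"
    if v: "CARD('n) < card {i. \<bar>column i X \<bullet> v\<bar> = lam}" for X :: "real^'p^'n" and v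
  proof -
    define A where "A = {i. \<bar>column i X \<bullet> v\<bar> = lam}"
    define P where "P = {i. column i X \<bullet> v > 0}"
    have "\<forall>i\<in>A. column i X \<bullet> v = s P i"
      by (auto simp: A_def P_def s_def)
    moreover have "v \<noteq> 0"
      using v assms by auto
    ultimately show ?thesis using v unfolding A_def by blast
  qed
  ultimately show ?thesis
    by (elim negligible_subset) blast
qed

section \<open>Existence of minimizers for almost all matrices\<close>

lemma l1_norm_scaleR: "l1_norm (c *\<^sub>R \<beta>) = \<bar>c\<bar> * l1_norm \<beta>"
  by (simp add: l1_norm_def abs_mult sum_distrib_left)

lemma norm_le_l1_norm: "norm \<beta> \<le> l1_norm \<beta>"
  using norm_le_l1_cart[of \<beta>] by (simp add: l1_norm_def)

lemma l1_norm_nonneg: "0 \<le> l1_norm \<beta>"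
  by (simp add: l1_norm_def sum_nonneg)

lemma continuous_on_l1_objective:
  assumes "continuous_on UNIV f"
  shows "continuous_on UNIV (l1_objective f X lam)"
  unfolding l1_objective_def[abs_def] l1_norm_def
  by (intro continuous_on_add continuous_on_mult continuous_on_const continuous_on_sum
      continuous_on_rabs continuous_on_component continuous_on_id
      continuous_on_compose2[OF assms matrix_vector_mult_linear_continuous_on]) simp

text \<open>
  After the substitution \<open>\<beta> \<mapsto> c *\<^sub>R \<beta>\<close>, scaling the matrix amounts to scaling the penalty weight.
\<close>
lemma l1_objective_scale_matrix:
  assumes "c > 0"
  shows "l1_objective f (c *\<^sub>R X) lam \<beta> = l1_objective f X (lam / c) (c *\<^sub>R \<beta>)"
  using assms
  by (simp add: l1_objective_def l1_norm_scaleR scaleR_matrix_vector_assoc matrix_vector_mult_scaleR)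

lemma bdd_below_l1_objective_scale_matrix:
  fixes X :: "real^'p^'n"
  assumes "c > 0"
  shows "bdd_below (range (l1_objective f (c *\<^sub>R X) lam)) \<longleftrightarrow>
         bdd_below (range (l1_objective f X (lam / c)))"
proof -
  have "\<beta> = c *\<^sub>R (inverse c *\<^sub>R \<beta>)" for \<beta> :: "real^'p" using assms by simp
  then have "surj ((*\<^sub>R) c :: real^'p \<Rightarrow> real^'p)" by blast
  moreover have "range (l1_objective f (c *\<^sub>R X) lam) = l1_objective f X (lam / c) ` range ((*\<^sub>R) c)"
    using assms by (auto simp: l1_objective_scale_matrix)
  ultimately show ?thesis by simp
qed

lemma bdd_below_l1_objective_mono:
  assumes "bdd_below (range (l1_objective f X \<mu>))" "\<mu> \<le> lam"
  shows "bdd_below (range (l1_objective f X lam))"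
proof -
  have "l1_objective f X \<mu> \<beta> \<le> l1_objective f X lam \<beta>" for \<beta>
    using assms(2) l1_norm_nonneg[of \<beta>] by (simp add: l1_objective_def mult_right_mono)
  moreover obtain m where "\<And>\<beta>. m \<le> l1_objective f X \<mu> \<beta>"
    using assms(1) by (auto simp: bdd_below_def)
  ultimately have "m \<le> l1_objective f X lam \<beta>" for \<beta>
    by (rule order_trans[rotated])
  then show ?thesis by (auto simp: bdd_below_def)
qed

text \<open>
  If the objective is bounded below already for a smaller weight \<open>\<mu>\<close>, the objective for \<open>lam\<close>
  exceeds a constant plus \<open>(lam - \<mu>) * l1_norm \<beta>\<close>, so its sublevel sets are compact.
\<close>
lemma l1_solution_exists:
  fixes X :: "real^'p^'n"
  assumes cont: "continuous_on UNIV f"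
    and bdd: "bdd_below (range (l1_objective f X \<mu>))" and less: "\<mu> < lam"
  shows "\<exists>\<beta>. l1_solution f X lam \<beta>"
proof -
  obtain m where m: "\<And>\<beta>. m \<le> l1_objective f X \<mu> \<beta>"
    using bdd by (auto simp: bdd_below_def)
  define G where "G = l1_objective f X lam"
  define S where "S = {\<beta>. G \<beta> \<le> G 0}"
  have cG: "continuous_on UNIV G"
    unfolding G_def by (rule continuous_on_l1_objective[OF cont])
  have "norm \<beta> \<le> (G 0 - m) / (lam - \<mu>)" if "\<beta> \<in> S" for \<beta>
  proof -
    have "m + (lam - \<mu>) * l1_norm \<beta> \<le> G 0"
      using that m[of \<beta>] by (simp add: S_def G_def l1_objective_def algebra_simps)
    then have "l1_norm \<beta> \<le> (G 0 - m) / (lam - \<mu>)"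
      using less by (simp add: field_simps)
    with norm_le_l1_norm[of \<beta>] show ?thesis by linarith
  qed
  then have "bounded S" unfolding bounded_iff by blast
  moreover have "closed S"
    unfolding S_def by (intro closed_Collect_le cG continuous_on_const)
  ultimately have "compact S" by (simp add: compact_eq_bounded_closed)
  moreover have "0 \<in> S" by (simp add: S_def)
  ultimately obtain \<beta> where \<beta>: "\<beta> \<in> S" "\<And>\<gamma>. \<gamma> \<in> S \<Longrightarrow> G \<beta> \<le> G \<gamma>"
    using continuous_attains_inf[of S G] continuous_on_subset[OF cG] by blast
  have "G \<beta> \<le> G \<gamma>" for \<gamma>
    using \<beta>(1) \<beta>(2)[of \<gamma>] unfolding S_def by (cases "G \<gamma> \<le> G 0") auto
  then show ?thesis
    unfolding l1_solution_def is_arg_min_linorder G_def by blast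
qed

text \<open>
  The matrices for which \<open>lam\<close> is the least weight making the objective bounded below.  Only for
  these can the objective be bounded below without being coercive.
\<close>
definition threshold_matrices :: "(real^'n \<Rightarrow> real) \<Rightarrow> real \<Rightarrow> (real^'p^'n) set" where
  "threshold_matrices f lam = {X. bdd_below (range (l1_objective f X lam)) \<and>
     (\<forall>\<mu><lam. \<not> bdd_below (range (l1_objective f X \<mu>)))}"

text \<open>
  For each lower bound the condition is closed in \<open>X\<close>, so the set is a countable union of closed
  sets.
\<close>
lemma borel_bdd_below_l1_objective:
  fixes f :: "real^'n \<Rightarrow> real"
  assumes cont: "continuous_on UNIV f"
  shows "{X :: real^'p^'n. bdd_below (range (l1_objective f X lam))} \<in> sets borel"
proof -
  have "{X :: real^'p^'n. bdd_below (range (l1_objective f X lam))}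
      = (\<Union>k::nat. \<Inter>\<beta>. {X. - real k \<le> l1_objective f X lam \<beta>})"
  proof (intro set_eqI iffI)
    fix X :: "real^'p^'n"
    assume "X \<in> {X. bdd_below (range (l1_objective f X lam))}"
    then obtain m where m: "\<And>\<beta>. m \<le> l1_objective f X lam \<beta>"
      by (auto simp: bdd_below_def)
    obtain k :: nat where "- m \<le> real k" using real_arch_simple by blast
    then have "- real k \<le> l1_objective f X lam \<beta>" for \<beta> using m[of \<beta>] by linarith
    then show "X \<in> (\<Union>k::nat. \<Inter>\<beta>. {X. - real k \<le> l1_objective f X lam \<beta>})" by blast
  qed (auto simp: bdd_below_def)
  moreover have "closed (\<Inter>\<beta>. {X :: real^'p^'n. - real k \<le> l1_objective f X lam \<beta>})" for k
  proof (intro closed_INT ballI closed_Collect_le continuous_on_const)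
    fix \<beta> :: "real^'p"
    have "linear (\<lambda>X::real^'p^'n. X *v \<beta>)"
      by (auto intro!: linearI simp: matrix_vector_mult_add_rdistrib scaleR_matrix_vector_assoc)
    then have "continuous_on UNIV (\<lambda>X::real^'p^'n. X *v \<beta>)"
      by (intro linear_continuous_on linear_conv_bounded_linear[THEN iffD1])
    then show "continuous_on UNIV (\<lambda>X::real^'p^'n. l1_objective f X lam \<beta>)"
      unfolding l1_objective_def
      by (intro continuous_intros continuous_on_compose2[OF cont]) auto
  qed
  ultimately show ?thesis by auto
qed

text \<open>
  Passing from \<open>X\<close> to \<open>c *\<^sub>R X\<close> divides the weight by \<open>c\<close>, so it multiplies the threshold weight
  by \<open>c\<close>.  Hence each ray from the origin contains at most one matrix with threshold \<open>lam\<close>, and a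
  measurable set with this property is null.
\<close>
lemma negligible_threshold_matrices:
  fixes f :: "real^'n \<Rightarrow> real"
  assumes cont: "continuous_on UNIV f" and "lam > 0"
  shows "negligible (threshold_matrices f lam :: (real^'p^'n) set)"
proof -
  let ?B = "\<lambda>\<mu>. {X :: real^'p^'n. bdd_below (range (l1_objective f X \<mu>))}"
  have "threshold_matrices f lam = ?B lam - (\<Union>k::nat. ?B (lam - 1 / real (Suc k)))"
  proof (intro set_eqI iffI)
    fix X assume X: "X \<in> ?B lam - (\<Union>k::nat. ?B (lam - 1 / real (Suc k)))"
    have "\<not> bdd_below (range (l1_objective f X \<mu>))" if less: "\<mu> < lam" for \<mu>
    proof
      assume bdd: "bdd_below (range (l1_objective f X \<mu>))"
      obtain k where "1 / real (Suc k) < lam - \<mu>"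
        using less nat_approx_posE[of "lam - \<mu>"] by auto
      then have "X \<in> ?B (lam - 1 / real (Suc k))"
        using bdd_below_l1_objective_mono[OF bdd] by simp
      with X show False by blast
    qed
    with X show "X \<in> threshold_matrices f lam"
      by (simp add: threshold_matrices_def)
  qed (auto simp: threshold_matrices_def)
  moreover have "?B \<mu> \<in> sets borel" for \<mu>
    by (rule borel_bdd_below_l1_objective[OF cont])
  ultimately have borel: "threshold_matrices f lam \<in> sets (borel :: (real^'p^'n) measure)"
    by auto
  have ray: "c = 1" if cX: "c *\<^sub>R X \<in> threshold_matrices f lam" "0 \<le> c"
    and X: "X \<in> threshold_matrices f lam" for c and X :: "real^'p^'n"
  proof -
    have "l1_objective f 0 0 = (\<lambda>\<beta>::real^'p. f 0)"
      by (simp add: l1_objective_def fun_eq_iff)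
    then have "(0 :: real^'p^'n) \<notin> threshold_matrices f lam"
      using \<open>lam > 0\<close> by (auto simp: threshold_matrices_def)
    with cX have c: "c > 0" by (cases "c = 0") auto
    note scale = bdd_below_l1_objective_scale_matrix[OF c, of f X]
    \<comment> \<open>If \<open>c > 1\<close>, boundedness for \<open>c *\<^sub>R X\<close> contradicts minimality of the weight for \<open>X\<close>;
        if \<open>c < 1\<close>, boundedness for \<open>X\<close> contradicts minimality for \<open>c *\<^sub>R X\<close>.\<close>
    have "\<not> lam / c < lam"
      using cX(1) X scale[of lam] by (auto simp: threshold_matrices_def)
    moreover have "\<not> c * lam < lam"
      using cX(1) X scale[of "c * lam"] c by (auto simp: threshold_matrices_def)
    ultimately show "c = 1"
      using c \<open>lam > 0\<close> by (simp add: field_simps)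
  qed
  have "negligible (threshold_matrices f lam \<inter> cbox a b)" for a b :: "real^'p^'n"
    unfolding negligible_iff_null_sets
  proof (rule starlike_negligible_bounded_gmeasurable)
    show "threshold_matrices f lam \<inter> cbox a b \<in> sets lebesgue"
      using borel by (intro sets_completionI_sets) auto
    show "bounded (threshold_matrices f lam \<inter> cbox a b)"
      by (rule bounded_subset[OF bounded_cbox[of a b]]) (rule Int_lower2)
    show "c = 1" if "c *\<^sub>R X \<in> threshold_matrices f lam \<inter> cbox a b" "0 \<le> c"
      "X \<in> threshold_matrices f lam \<inter> cbox a b" for c X
      using ray[of c X] that by simp
  qed
  then show ?thesis
    using negligible_on_intervals by blast
qed

section \<open>Sparsity and uniqueness of minimizers\<close>

text \<open>
  The stationarity condition in the coordinates of the support; \<open>v\<close> is the gradient of \<open>f\<close> at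
  \<open>X *v \<beta>\<close>.
\<close>
lemma l1_solution_gradient:
  fixes X :: "real^'p^'n"
  assumes diff: "f differentiable (at (X *v \<beta>))" and sol: "l1_solution f X lam \<beta>"
  obtains v where "\<And>i. \<beta> $ i \<noteq> 0 \<Longrightarrow> column i X \<bullet> v = - lam * sgn (\<beta> $ i)"
proof -
  obtain f' where f': "(f has_derivative f') (at (X *v \<beta>))"
    using diff by (auto simp: differentiable_def)
  have lin: "linear f'" using f' by (rule has_derivative_linear)
  define v where "v = (\<chi> q. f' (axis q 1))"
  have gradient: "f' u = u \<bullet> v" for u
  proof -
    have "f' u = f' (\<Sum>q\<in>UNIV. u $ q *\<^sub>R axis q 1)"
      using basis_expansion[of u] by (simp add: scalar_mult_eq_scaleR)
    also have "\<dots> = u \<bullet> v"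
      by (simp add: linear_sum[OF lin] linear_cmul[OF lin] inner_vec_def v_def)
    finally show ?thesis .
  qed
  have "column i X \<bullet> v = - lam * sgn (\<beta> $ i)" if i: "\<beta> $ i \<noteq> 0" for i
  proof -
    define C where "C = (\<Sum>j\<in>UNIV - {i}. \<bar>\<beta> $ j\<bar>)"
    \<comment> \<open>The penalty is not differentiable, but while \<open>\<bar>t\<bar> < \<bar>\<beta> $ i\<bar>\<close> the sign of coordinate \<open>i\<close> does
        not change, so the objective along this axis agrees near 0 with the differentiable \<open>\<psi>\<close>.\<close>
    define \<psi> where "\<psi> t = f (X *v \<beta> + t *\<^sub>R column i X) + lam * (C + sgn (\<beta> $ i) * (\<beta> $ i + t))" for t
    have \<psi>: "l1_objective f X lam (\<beta> + t *\<^sub>R axis i 1) = \<psi> t" if t: "\<bar>t\<bar> < \<bar>\<beta> $ i\<bar>" for t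
    proof -
      have "l1_norm (\<beta> + t *\<^sub>R axis i 1) = \<bar>\<beta> $ i + t\<bar> + (\<Sum>j\<in>UNIV - {i}. \<bar>(\<beta> + t *\<^sub>R axis i 1) $ j\<bar>)"
        unfolding l1_norm_def by (subst sum.remove[of UNIV i]) simp_all
      also have "(\<Sum>j\<in>UNIV - {i}. \<bar>(\<beta> + t *\<^sub>R axis i 1) $ j\<bar>) = C"
        unfolding C_def by (intro sum.cong) (auto simp: axis_def)
      also have "\<bar>\<beta> $ i + t\<bar> = sgn (\<beta> $ i) * (\<beta> $ i + t)"
        using t by (auto simp: sgn_if abs_if split: if_splits)
      finally show ?thesis
        by (simp add: l1_objective_def \<psi>_def matrix_vector_right_distrib
            matrix_vector_mult_scaleR matrix_vector_mult_basis)
    qed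
    have "((\<lambda>t. f (X *v \<beta> + t *\<^sub>R column i X)) has_derivative
        (\<lambda>t. f' (t *\<^sub>R column i X))) (at 0)"
      by (rule has_derivative_compose[where g=f and f="\<lambda>t. X *v \<beta> + t *\<^sub>R column i X"])
         (auto intro!: derivative_eq_intros f')
    then have "((\<lambda>t. f (X *v \<beta> + t *\<^sub>R column i X)) has_real_derivative (column i X \<bullet> v)) (at 0)"
      by (simp add: has_field_derivative_def gradient mult.commute[of _ "column i X \<bullet> v"])
    then have "(\<psi> has_real_derivative (column i X \<bullet> v + lam * sgn (\<beta> $ i))) (at 0)"
      unfolding \<psi>_def by (auto intro!: derivative_eq_intros)
    moreover have "\<psi> 0 \<le> \<psi> t" if "\<bar>t\<bar> < \<bar>\<beta> $ i\<bar>" for t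
    proof -
      have "l1_objective f X lam \<beta> \<le> l1_objective f X lam (\<beta> + t *\<^sub>R axis i 1)"
        using sol by (simp add: l1_solution_def is_arg_min_linorder)
      then show ?thesis using \<psi>[OF that] \<psi>[of 0] i by simp
    qed
    ultimately have "column i X \<bullet> v + lam * sgn (\<beta> $ i) = 0"
      using i by (intro DERIV_local_min[of \<psi> _ 0 "\<bar>\<beta> $ i\<bar>"]) auto
    then show ?thesis by simp
  qed
  then show thesis by (rule that)
qed

text \<open>
  By stationarity the support of a solution lies in the equicorrelation set of the gradient.
\<close>
lemma card_support_le_equicorrelation_bound:
  fixes X :: "real^'p^'n"
  assumes "f differentiable (at (X *v \<beta>))" "l1_solution f X lam \<beta>" "lam > 0"
    and bound: "\<And>v. card {i. \<bar>column i X \<bullet> v\<bar> = lam} \<le> k"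
  shows "card {i. \<beta> $ i \<noteq> 0} \<le> k"
proof -
  obtain v where v: "\<And>i. \<beta> $ i \<noteq> 0 \<Longrightarrow> column i X \<bullet> v = - lam * sgn (\<beta> $ i)"
    using l1_solution_gradient assms(1,2) by blast
  then have "{i. \<beta> $ i \<noteq> 0} \<subseteq> {i. \<bar>column i X \<bullet> v\<bar> = lam}"
    using \<open>lam > 0\<close> by (auto simp: abs_mult abs_sgn_eq)
  then show ?thesis
    using bound[of v] by (meson card_mono finite order_trans)
qed

text \<open>
  The average of two minimal values is again minimal, so all convexity inequalities between them
  are equalities.  For \<open>f\<close> this forces equal fits by strict convexity; for the penalty it excludes
  cancellation in any coordinate, so the midpoint vanishes only where both solutions do.
\<close>
lemma l1_solution_midpoint:
  fixes X :: "real^'p^'n"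
  assumes f: "strictly_convex_on UNIV f" and "lam > 0"
    and \<beta>: "l1_solution f X lam \<beta>" and \<gamma>: "l1_solution f X lam \<gamma>"
  defines "m \<equiv> (1/2) *\<^sub>R \<beta> + (1/2) *\<^sub>R \<gamma>"
  shows "X *v \<beta> = X *v \<gamma>"
    and "l1_solution f X lam m"
    and "{i. \<beta> $ i \<noteq> \<gamma> $ i} \<subseteq> {i. m $ i \<noteq> 0}"
proof -
  define G where "G = l1_objective f X lam"
  have G_min: "G \<beta> \<le> G \<delta>" "G \<gamma> \<le> G \<delta>" for \<delta>
    using \<beta> \<gamma> by (simp_all add: l1_solution_def is_arg_min_linorder G_def)
  then have G_eq: "G \<beta> = G \<gamma>" by (simp add: order_antisym)
  \<comment> \<open>The loss in the triangle inequality in coordinate \<open>i\<close>.\<close>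
  define gap where "gap i = (\<bar>\<beta> $ i\<bar> + \<bar>\<gamma> $ i\<bar>) / 2 - \<bar>m $ i\<bar>" for i
  have gap_nonneg: "gap i \<ge> 0" for i
    unfolding gap_def m_def by (simp add: abs_if)
  have gap_sum: "(l1_norm \<beta> + l1_norm \<gamma>) / 2 - l1_norm m = sum gap UNIV"
    unfolding gap_def l1_norm_def
    by (simp add: sum_subtractf sum.distrib add_divide_distrib flip: sum_divide_distrib)
  have "sum gap UNIV \<ge> 0" by (simp add: gap_nonneg sum_nonneg)
  then have l1_m: "lam * l1_norm m \<le> lam * ((l1_norm \<beta> + l1_norm \<gamma>) / 2)"
    using gap_sum \<open>lam > 0\<close> by (intro mult_left_mono) linarith+
  have Xm: "X *v m = (1/2) *\<^sub>R (X *v \<beta>) + (1/2) *\<^sub>R (X *v \<gamma>)"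
    by (simp add: m_def matrix_vector_right_distrib matrix_vector_mult_scaleR)
  show fit: "X *v \<beta> = X *v \<gamma>"
  proof (rule ccontr)
    assume "X *v \<beta> \<noteq> X *v \<gamma>"
    then have "\<forall>t. 0 < t \<and> t < 1 \<longrightarrow> f ((1 - t) *\<^sub>R (X *v \<beta>) + t *\<^sub>R (X *v \<gamma>))
        < (1 - t) * f (X *v \<beta>) + t * f (X *v \<gamma>)"
      using f unfolding strictly_convex_on_def by blast
    from this[THEN spec, of "1/2"] have "f (X *v m) < (f (X *v \<beta>) + f (X *v \<gamma>)) / 2"
      by (simp add: Xm add_divide_distrib)
    then have "G m < (G \<beta> + G \<gamma>) / 2"
      using l1_m by (simp add: G_def l1_objective_def field_simps)
    with G_min(1)[of m] G_eq show False by simp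
  qed
  then have "X *v m = X *v \<beta>"
    unfolding Xm by (simp flip: scaleR_add_left)
  moreover have "l1_norm \<beta> = l1_norm \<gamma>"
    using fit G_eq \<open>lam > 0\<close> by (simp add: G_def l1_objective_def)
  ultimately have G_gap: "G m = G \<beta> - lam * sum gap UNIV"
    unfolding G_def l1_objective_def gap_sum[symmetric] by (simp add: algebra_simps)
  then have "lam * sum gap UNIV \<le> 0"
    using G_min(1)[of m] by simp
  then have gap0: "sum gap UNIV = 0"
    using \<open>sum gap UNIV \<ge> 0\<close> \<open>lam > 0\<close> by (simp add: mult_le_0_iff)
  then have "G m = G \<beta>" using G_gap by simp
  then show "l1_solution f X lam m"
    using G_min(1) by (simp add: l1_solution_def is_arg_min_linorder G_def)
  have gap_zero: "gap i = 0" for i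
    using gap0 gap_nonneg by (simp add: sum_nonneg_eq_0_iff)
  have "m $ i \<noteq> 0" if "\<beta> $ i \<noteq> \<gamma> $ i" for i
    using gap_zero[of i] that abs_triangle_ineq4[of "\<beta> $ i" "\<gamma> $ i"]
    unfolding gap_def by auto
  then show "{i. \<beta> $ i \<noteq> \<gamma> $ i} \<subseteq> {i. m $ i \<noteq> 0}" by blast
qed

text \<open>
  The difference of two solutions is annihilated by \<open>X\<close> and supported in the support of their
  midpoint, hence in at most \<open>CARD('n)\<close> coordinates, where the columns admit no dependence.
\<close>
lemma l1_solution_unique:
  fixes X :: "real^'p^'n"
  assumes f: "f differentiable_on UNIV" "strictly_convex_on UNIV f" and "lam > 0"
    and equi: "\<And>v. card {i. \<bar>column i X \<bullet> v\<bar> = lam} \<le> CARD('n)"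
    and indep: "\<And>d. card {j. d $ j \<noteq> 0} \<le> CARD('n) \<Longrightarrow> X *v d = 0 \<Longrightarrow> d = 0"
    and \<beta>: "l1_solution f X lam \<beta>" and \<gamma>: "l1_solution f X lam \<gamma>"
  shows "\<beta> = \<gamma>"
proof -
  note mid = l1_solution_midpoint[OF f(2) \<open>lam > 0\<close> \<beta> \<gamma>]
  have diff: "f differentiable (at u)" for u
    using f(1) by (simp add: differentiable_on_def)
  have "card {i. (\<beta> - \<gamma>) $ i \<noteq> 0} \<le> CARD('n)"
    using card_mono[OF finite mid(3)]
      card_support_le_equicorrelation_bound[OF diff mid(2) \<open>lam > 0\<close> equi]
    by simp
  moreover have "X *v (\<beta> - \<gamma>) = 0"
    using mid(1) by (simp add: matrix_vector_mult_diff_distrib)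
  ultimately show ?thesis using indep[of "\<beta> - \<gamma>"] by simp
qed

section \<open>Random matrices\<close>

lemma AE_notin_negligible_of_absolutely_continuous:
  fixes X :: "'a \<Rightarrow> 'b::euclidean_space"
  assumes "X \<in> borel_measurable M" "absolutely_continuous lborel (distr M borel X)" "negligible N"
  shows "AE \<omega> in M. X \<omega> \<notin> N"
proof -
  have "AE x in lebesgue. x \<notin> N"
    using assms(3) by (intro AE_not_in) (simp add: negligible_iff_null_sets)
  then have "AE x in lborel. x \<notin> N" by (simp add: AE_completion_iff)
  then have "AE x in distr M borel X. x \<notin> N"
    by (rule absolutely_continuous_AE[OF _ assms(2), rotated]) simp
  then show ?thesis by (rule AE_distrD[OF assms(1)])
qed

theorem lemma5:
  fixes M :: "'a measure"
    and X :: "'a \<Rightarrow> real ^ 'p ^ 'n"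
    and f :: "real ^ 'n \<Rightarrow> real"
    and lam :: real
  assumes "prob_space M"
    and "X \<in> borel_measurable M"
    and "absolutely_continuous lborel (distr M borel X)"
    and "f differentiable_on UNIV"
    and "strictly_convex_on UNIV f"
    and "lam > 0"
  shows "AE \<omega> in M. bdd_below (range (l1_objective f (X \<omega>) lam)) \<longrightarrow>
           (\<exists>!\<beta>. l1_solution f (X \<omega>) lam \<beta>) \<and>
           (\<forall>\<beta>. l1_solution f (X \<omega>) lam \<beta> \<longrightarrow>
                card {i. \<beta> $ i \<noteq> 0} \<le> min CARD('n) CARD('p))"
proof -
  note lam = \<open>lam > 0\<close>
  have cont: "continuous_on UNIV f"
    using assms(4) by (rule differentiable_imp_continuous_on)
  have diff: "f differentiable (at u)" for u
    using assms(4) by (simp add: differentiable_on_def)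
  define N where "N = threshold_matrices f lam
      \<union> {X :: real^'p^'n. \<exists>d. d \<noteq> 0 \<and> card {j. d $ j \<noteq> 0} \<le> CARD('n) \<and> X *v d = 0}
      \<union> {X. \<exists>v. CARD('n) < card {i. \<bar>column i X \<bullet> v\<bar> = lam}}"
  have "negligible N"
    unfolding N_def
    by (intro negligible_Un negligible_threshold_matrices[OF cont lam]
        negligible_short_dependence negligible_large_equicorrelation_set[OF lam])
  then have "AE \<omega> in M. X \<omega> \<notin> N"
    by (rule AE_notin_negligible_of_absolutely_continuous[OF assms(2,3)])
  then show ?thesis
  proof (rule AE_mp, intro AE_I2 impI)
    fix \<omega>
    assume generic: "X \<omega> \<notin> N" and bdd: "bdd_below (range (l1_objective f (X \<omega>) lam))"
    have equi: "card {i. \<bar>column i (X \<omega>) \<bullet> v\<bar> = lam} \<le> CARD('n)" for v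
      using generic unfolding N_def by (auto simp: not_less)
    have indep: "d = 0" if "card {j. d $ j \<noteq> 0} \<le> CARD('n)" "X \<omega> *v d = 0" for d
      using generic that unfolding N_def by blast
    obtain \<mu> where "\<mu> < lam" "bdd_below (range (l1_objective f (X \<omega>) \<mu>))"
      using generic bdd unfolding N_def threshold_matrices_def by blast
    then have "\<exists>\<beta>. l1_solution f (X \<omega>) lam \<beta>"
      using l1_solution_exists[OF cont] by blast
    then have "\<exists>!\<beta>. l1_solution f (X \<omega>) lam \<beta>"
      using l1_solution_unique[OF assms(4,5) lam equi indep] by blast
    moreover have "card {i. \<beta> $ i \<noteq> 0} \<le> min CARD('n) CARD('p)"
      if "l1_solution f (X \<omega>) lam \<beta>" for \<beta>
      using card_support_le_equicorrelation_bound[OF diff that lam equi]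
        card_mono[of UNIV "{i. \<beta> $ i \<noteq> 0}"] by simp
    ultimately show "(\<exists>!\<beta>. l1_solution f (X \<omega>) lam \<beta>) \<and>
        (\<forall>\<beta>. l1_solution f (X \<omega>) lam \<beta> \<longrightarrow> card {i. \<beta> $ i \<noteq> 0} \<le> min CARD('n) CARD('p))"
      by blast
  qed
qed

end
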